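(* Every Riemannian nilsoliton is $T^*$-solitary; that is, if $\mathfrak g$ is a finite-dimensional real nilpotent Lie algebra carrying a Riemannian metric (positive-definite inner product) whose Ricci operator satisfies $\mathrm{ric}=\lambda\,\mathrm{Id}+D$ for some $\lambda\in\mathbb R$ and some derivation $D$ of $\mathfrak g$, then $\mathfrak g$ is $T^*$-solitary.
   Context: The Ricci operator of an inner product on $\mathfrak g$ is the Ricci operator, at the identity, of the corresponding left-invariant Riemannian metric on the simply connected Lie group with Lie algebra $\mathfrak g$. For a linear map $\phi\colon\mathfrak g\to\mathfrak g^*$: its transpose is ${}^t\phi\colon\mathfrak g\to\mathfrak g^*$, ${}^t\phi(X)(Y)=\phi(Y)(X)$; $\phi$ is symmetric if $\phi={}^t\phi$; $\phi$ is ad-invariant if $\phi([X,Y])(Z)=-\phi(Y)([X,Z])$ for all $X,Y,Z\in\mathfrak g$. A linear map $D\colon\mathfrak g\to\mathfrak g^*$ is a derivation if $D([X,Y])(Z)=D(X)([Y,Z])-D(Y)([X,Z])$ for all $X,Y,Z\in\mathfrak g$. $\mathfrak g$ is $T^*$-solitary if every ad-invariant symmetric linear map $\phi\colon\mathfrak g\to\mathfrak g^*$ can be written as $\phi=D+{}^tD$ for some derivation $D\colon\mathfrak g\to\mathfrak g^*$. *)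

theory Defs
  imports "HOL-Analysis.Analysis"
begin

text \<open>
  A real Lie algebra is a bracket on a type of class \<open>real_vector\<close>. Linear maps
  \<open>\<gg> \<rightarrow> \<gg>\<^sup>*\<close> are given in curried form, i.e. as functions
  \<open>\<phi> :: 'a \<Rightarrow> 'a \<Rightarrow> real\<close> with \<open>bilinear \<phi>\<close>.
\<close>

definition lie_algebra :: "('a::real_vector \<Rightarrow> 'a \<Rightarrow> 'a) \<Rightarrow> bool" where
  "lie_algebra br \<longleftrightarrow> bilinear br \<and> (\<forall>X. br X X = 0) \<and>
     (\<forall>X Y Z. br X (br Y Z) + br Y (br Z X) + br Z (br X Y) = 0)"

fun lower_central_series :: "('a::real_vector \<Rightarrow> 'a \<Rightarrow> 'a) \<Rightarrow> nat \<Rightarrow> 'a set" where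
  "lower_central_series br 0 = UNIV"
| "lower_central_series br (Suc k) = span {br X Y | X Y. Y \<in> lower_central_series br k}"

definition nilpotent_lie_algebra :: "('a::real_vector \<Rightarrow> 'a \<Rightarrow> 'a) \<Rightarrow> bool" where
  "nilpotent_lie_algebra br \<longleftrightarrow> lie_algebra br \<and> (\<exists>k. lower_central_series br k = {0})"

definition lie_derivation :: "('a::real_vector \<Rightarrow> 'a \<Rightarrow> 'a) \<Rightarrow> ('a \<Rightarrow> 'a) \<Rightarrow> bool" where
  "lie_derivation br D \<longleftrightarrow> linear D \<and> (\<forall>X Y. D (br X Y) = br (D X) Y + br X (D Y))"

definition finite_dimensional :: "'a::real_vector itself \<Rightarrow> bool" where
  "finite_dimensional _ \<longleftrightarrow> (\<exists>B::'a set. finite B \<and> span B = UNIV)"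

definition inner_product :: "('a::real_vector \<Rightarrow> 'a \<Rightarrow> real) \<Rightarrow> bool" where
  "inner_product g \<longleftrightarrow> bilinear g \<and> (\<forall>X Y. g X Y = g Y X) \<and> (\<forall>X. X \<noteq> 0 \<longrightarrow> g X X > 0)"

text \<open>
  Trace of an endomorphism of a finite-dimensional space; \<open>extend_basis {}\<close> is an
  arbitrary basis (see \<open>endo_trace_eq\<close> below).
\<close>

definition endo_trace :: "('a::real_vector \<Rightarrow> 'a) \<Rightarrow> real" where
  "endo_trace f = (\<Sum>b\<in>extend_basis {}. representation (extend_basis {}) (f b) b)"

text \<open>
  Curvature of the left-invariant metric determined by \<open>g\<close>, restricted to left-invariant
  fields, which are identified with their values at the identity. For left-invariant
  \<open>X\<close>, \<open>Y\<close> the field \<open>\<nabla>\<^sub>X Y\<close> is again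
  left-invariant and the functions \<open>g X Y\<close> are constant, so the two conditions below are
  exactly vanishing of torsion and metric compatibility of the Levi-Civita connection.
\<close>

definition is_levi_civita ::
  "('a::real_vector \<Rightarrow> 'a \<Rightarrow> 'a) \<Rightarrow> ('a \<Rightarrow> 'a \<Rightarrow> real) \<Rightarrow> ('a \<Rightarrow> 'a \<Rightarrow> 'a) \<Rightarrow> bool" where
  "is_levi_civita br g N \<longleftrightarrow> bilinear N \<and>
     (\<forall>X Y. N X Y - N Y X = br X Y) \<and>
     (\<forall>X Y Z. g (N X Y) Z + g Y (N X Z) = 0)"

definition levi_civita ::
  "('a::real_vector \<Rightarrow> 'a \<Rightarrow> 'a) \<Rightarrow> ('a \<Rightarrow> 'a \<Rightarrow> real) \<Rightarrow> 'a \<Rightarrow> 'a \<Rightarrow> 'a" where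
  "levi_civita br g = (THE N. is_levi_civita br g N)"

definition curvature ::
  "('a::real_vector \<Rightarrow> 'a \<Rightarrow> 'a) \<Rightarrow> ('a \<Rightarrow> 'a \<Rightarrow> real) \<Rightarrow> 'a \<Rightarrow> 'a \<Rightarrow> 'a \<Rightarrow> 'a" where
  "curvature br g X Y Z =
     (let N = levi_civita br g in N X (N Y Z) - N Y (N X Z) - N (br X Y) Z)"

definition ricci_tensor ::
  "('a::real_vector \<Rightarrow> 'a \<Rightarrow> 'a) \<Rightarrow> ('a \<Rightarrow> 'a \<Rightarrow> real) \<Rightarrow> 'a \<Rightarrow> 'a \<Rightarrow> real" where
  "ricci_tensor br g Y Z = endo_trace (\<lambda>X. curvature br g X Y Z)"

definition ricci_operator ::
  "('a::real_vector \<Rightarrow> 'a \<Rightarrow> 'a) \<Rightarrow> ('a \<Rightarrow> 'a \<Rightarrow> real) \<Rightarrow> 'a \<Rightarrow> 'a" where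
  "ricci_operator br g Y = (THE W. \<forall>Z. g W Z = ricci_tensor br g Y Z)"

definition ad_invariant :: "('a::real_vector \<Rightarrow> 'a \<Rightarrow> 'a) \<Rightarrow> ('a \<Rightarrow> 'a \<Rightarrow> real) \<Rightarrow> bool" where
  "ad_invariant br \<phi> \<longleftrightarrow> (\<forall>X Y Z. \<phi> (br X Y) Z = - \<phi> Y (br X Z))"

definition dual_transpose :: "('a \<Rightarrow> 'a \<Rightarrow> real) \<Rightarrow> 'a \<Rightarrow> 'a \<Rightarrow> real" where
  "dual_transpose \<phi> X Y = \<phi> Y X"

definition dual_derivation :: "('a::real_vector \<Rightarrow> 'a \<Rightarrow> 'a) \<Rightarrow> ('a \<Rightarrow> 'a \<Rightarrow> real) \<Rightarrow> bool" where
  "dual_derivation br D \<longleftrightarrow> bilinear D \<and>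
     (\<forall>X Y Z. D (br X Y) Z = D X (br Y Z) - D Y (br X Z))"

definition T_star_solitary :: "('a::real_vector \<Rightarrow> 'a \<Rightarrow> 'a) \<Rightarrow> bool" where
  "T_star_solitary br \<longleftrightarrow>
     (\<forall>\<phi>. bilinear \<phi> \<and> ad_invariant br \<phi> \<and> \<phi> = dual_transpose \<phi> \<longrightarrow>
        (\<exists>D. dual_derivation br D \<and> (\<forall>X Y. \<phi> X Y = D X Y + dual_transpose D X Y)))"

text \<open>
  The remaining lemmas show that the trace does not depend on the basis and that the
  definite descriptions above are well defined.
\<close>

lemma finite_extend_basis_empty:
  assumes "finite_dimensional TYPE('a::real_vector)"
  shows "finite (extend_basis {} :: 'a set)"
proof -
  obtain B :: "'a set" where "finite B" "span B = UNIV"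
    using assms by (auto simp: finite_dimensional_def)
  then show ?thesis
    using independent_span_bound[of B "extend_basis {}"] independent_extend_basis[of "{}::'a set"]
      independent_empty by auto
qed

lemma endo_trace_eq:
  fixes f :: "'a::real_vector \<Rightarrow> 'a" and B :: "'a set"
  assumes f: "linear f" and B: "finite B" "independent B" "span B = UNIV"
  shows "endo_trace f = (\<Sum>b\<in>B. representation B (f b) b)"
proof -
  let ?E = "extend_basis {} :: 'a set"
  let ?r = "representation ?E" and ?s = "representation B"
  have E: "finite ?E" "independent ?E" "span ?E = UNIV"
    using finite_extend_basis_empty B independent_extend_basis[of "{}::'a set"] independent_empty
    by (auto simp: finite_dimensional_def)
  interpret r: linear "\<lambda>v. ?r v b" for b
    using linear_representation[OF E(2,3)] by (simp add: linear_def real_scaleR_def[abs_def])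
  interpret s: linear "\<lambda>v. ?s v b" for b
    using linear_representation[OF B(2,3)] by (simp add: linear_def real_scaleR_def[abs_def])
  interpret f: linear f by (fact f)
  have eE: "(\<Sum>e\<in>?E. ?r v e *\<^sub>R e) = v" for v
    using E by (intro sum_representation_eq) auto
  have eB: "(\<Sum>b\<in>B. ?s v b *\<^sub>R b) = v" for v
    using B by (intro sum_representation_eq) auto
  have "endo_trace f = (\<Sum>e\<in>?E. ?r (f (\<Sum>b\<in>B. ?s e b *\<^sub>R b)) e)"
    by (simp add: endo_trace_def eB)
  also have "\<dots> = (\<Sum>e\<in>?E. \<Sum>b\<in>B. ?s e b * ?r (f b) e)"
    by (simp add: f.sum f.scaleR r.sum r.scaleR)
  also have "\<dots> = (\<Sum>b\<in>B. \<Sum>e\<in>?E. ?s e b * ?r (f b) e)"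
    by (rule sum.swap)
  also have "\<dots> = (\<Sum>b\<in>B. ?s (\<Sum>e\<in>?E. ?r (f b) e *\<^sub>R e) b)"
    by (simp add: s.sum s.scaleR mult.commute)
  finally show ?thesis by (simp add: eE)
qed

lemma inner_product_eqI:
  assumes g: "inner_product g" and eq: "\<And>Z. g V Z = g W Z"
  shows "V = W"
proof (rule ccontr)
  assume "V \<noteq> W"
  then have "g (V - W) (V - W) > 0" using g by (simp add: inner_product_def)
  moreover have "g (V - W) (V - W) = 0"
    using g eq[of "V - W"] by (simp add: inner_product_def bilinear_lsub)
  ultimately show False by simp
qed

lemma orthonormal_basis_exists:
  fixes g :: "'a::real_vector \<Rightarrow> 'a \<Rightarrow> real"
  assumes g: "inner_product g" and fd: "finite_dimensional TYPE('a)"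
  obtains E where "finite E" "independent E" "span E = UNIV"
    "\<And>c d. c \<in> E \<Longrightarrow> d \<in> E \<Longrightarrow> g c d = (if c = d then 1 else 0)"
    "\<And>X. (\<Sum>e\<in>E. g X e *\<^sub>R e) = X"
proof -
  have bl: "bilinear g" and sy: "\<And>X Y. g X Y = g Y X" and pos: "\<And>X. X \<noteq> 0 \<Longrightarrow> g X X > 0"
    using g by (auto simp: inner_product_def)
  interpret gl: linear "\<lambda>x. g x y" for y using bl by (simp add: bilinear_def)
  interpret gr: linear "\<lambda>y. g x y" for x using bl by (simp add: bilinear_def)
  have "\<exists>E. finite E \<and> span E = span B \<and> (\<forall>c\<in>E. \<forall>d\<in>E. g c d = (if c = d then 1 else 0))"
    if "finite B" for B
    using that
  proof induction
    case empty
    then show ?case by (intro exI[of _ "{}"]) auto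
  next
    case (insert x B)
    then obtain E where E: "finite E" "span E = span B"
      "\<And>c d. c \<in> E \<Longrightarrow> d \<in> E \<Longrightarrow> g c d = (if c = d then 1 else 0)" by blast
    define p where "p = (\<Sum>c\<in>E. g x c *\<^sub>R c)"
    define y where "y = x - p"
    have p: "p \<in> span E" unfolding p_def by (intro span_sum span_scale span_base)
    have y0: "g y d = 0" if "d \<in> E" for d
    proof -
      have "g p d = (\<Sum>c\<in>E. g x c * (if c = d then 1 else 0))"
        unfolding p_def gl.sum gl.scaleR using E(3) that by (intro sum.cong) auto
      also have "\<dots> = g x d" using E(1) that by (simp add: if_distrib[of "\<lambda>t. g x _ * t"] cong: if_cong)
      finally show ?thesis by (simp add: y_def gl.diff)
    qed
    have sp: "span (insert x B) = span (insert y E)"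
    proof -
      have "span (insert x B) = span (insert x E)"
        using E(2) by (simp add: span_insert)
      also have "\<dots> = span (insert y E)"
      proof (rule span_eq[THEN iffD2], intro conjI)
        have "p \<in> span (insert x E)" "p \<in> span (insert y E)"
          using p span_mono[OF subset_insertI] by blast+
        moreover have "x \<in> span (insert x E)" "y \<in> span (insert y E)" by (simp_all add: span_base)
        moreover have "x = y + p" "y = x - p" by (simp_all add: y_def)
        ultimately have "x \<in> span (insert y E)" "y \<in> span (insert x E)"
          by (metis span_add, metis span_diff)
        then show "insert x E \<subseteq> span (insert y E)" "insert y E \<subseteq> span (insert x E)"
          by (auto intro: span_base)
      qed
      finally show ?thesis .
    qed
    show ?case
    proof (cases "y = 0")
      case True
      then show ?thesis using E sp by (auto intro!: exI[of _ E] simp: span_insert_0)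
    next
      case False
      define r where "r = 1 / sqrt (g y y)"
      define z where "z = r *\<^sub>R y"
      have r: "r \<noteq> 0" "r * r * g y y = 1"
        using pos[OF False] by (auto simp: r_def)
      have zz: "g z z = 1" using r by (simp add: z_def gl.scaleR gr.scaleR mult.assoc)
      have z0: "g z d = 0" "g d z = 0" if "d \<in> E" for d
        using y0[OF that] sy[of d z] by (simp_all add: z_def gl.scaleR)
      have "span (insert z E) = span (insert y E)"
      proof (rule span_eq[THEN iffD2], intro conjI)
        have "z \<in> span (insert y E)" unfolding z_def by (intro span_scale span_base) simp
        then show "insert z E \<subseteq> span (insert y E)" by (auto intro: span_base)
        have "y = (1 / r) *\<^sub>R z" using r by (simp add: z_def)
        moreover have "(1 / r) *\<^sub>R z \<in> span (insert z E)" by (intro span_scale span_base) simp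
        ultimately have "y \<in> span (insert z E)" by simp
        then show "insert y E \<subseteq> span (insert z E)" by (auto intro: span_base)
      qed
      moreover have "\<forall>c\<in>insert z E. \<forall>d\<in>insert z E. g c d = (if c = d then 1 else 0)"
      proof -
        have "z \<notin> E" using z0 zz by fastforce
        then show ?thesis using E(3) zz z0 by auto
      qed
      ultimately show ?thesis using E(1) sp by (intro exI[of _ "insert z E"]) auto
    qed
  qed
  then obtain E :: "'a set" where E: "finite E" "span E = UNIV"
      "\<And>c d. c \<in> E \<Longrightarrow> d \<in> E \<Longrightarrow> g c d = (if c = d then 1 else 0)"
    using fd unfolding finite_dimensional_def by metis
  have coeff: "g (\<Sum>c\<in>E. u c *\<^sub>R c) d = u d" if "d \<in> E" for u d
  proof -
    have "g (\<Sum>c\<in>E. u c *\<^sub>R c) d = (\<Sum>c\<in>E. u c * (if c = d then 1 else 0))"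
      unfolding gl.sum gl.scaleR using E(3) that by (intro sum.cong) auto
    then show ?thesis using E(1) that by (simp add: if_distrib[of "\<lambda>t. u _ * t"] cong: if_cong)
  qed
  have "independent E"
  proof (rule independent_if_scalars_zero[OF E(1)])
    fix u d assume "(\<Sum>c\<in>E. u c *\<^sub>R c) = 0" "d \<in> E"
    then show "u d = 0" using coeff[of d u] gl.zero by simp
  qed
  moreover have "(\<Sum>e\<in>E. g X e *\<^sub>R e) = X" for X
  proof -
    have "X \<in> span E" using E(2) by simp
    then obtain u where u: "X = (\<Sum>c\<in>E. u c *\<^sub>R c)"
      using span_finite[OF E(1)] by auto
    have "g X e = u e" if "e \<in> E" for e
      using coeff[OF that, of u] u by simp
    then show ?thesis by (simp add: u[symmetric] cong: sum.cong)
  qed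
  ultimately show thesis using that E by blast
qed

lemma riesz_exists:
  fixes g :: "'a::real_vector \<Rightarrow> 'a \<Rightarrow> real"
  assumes g: "inner_product g" and fd: "finite_dimensional TYPE('a)" and l: "linear l"
  shows "\<exists>!W. \<forall>Z. g W Z = l Z"
proof -
  obtain E where E: "\<And>X. (\<Sum>e\<in>E. g X e *\<^sub>R e) = X"
    using orthonormal_basis_exists[OF g fd] by metis
  have bl: "bilinear g" and sy: "\<And>X Y. g X Y = g Y X"
    using g by (auto simp: inner_product_def)
  interpret gl: linear "\<lambda>x. g x y" for y using bl by (simp add: bilinear_def)
  interpret l: linear l by (fact l)
  have "g (\<Sum>e\<in>E. l e *\<^sub>R e) Z = l Z" for Z
  proof -
    have "g (\<Sum>e\<in>E. l e *\<^sub>R e) Z = (\<Sum>e\<in>E. g Z e * l e)"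
      by (simp add: gl.sum gl.scaleR sy[of Z] mult.commute)
    also have "\<dots> = l (\<Sum>e\<in>E. g Z e *\<^sub>R e)" by (simp add: l.sum l.scaleR)
    finally show ?thesis by (simp add: E)
  qed
  then show ?thesis using inner_product_eqI[OF g] by metis
qed

lemma levi_civita_koszul:
  assumes g: "inner_product g" and N: "is_levi_civita br g N"
  shows "2 * g (N X Y) Z = g (br X Y) Z - g (br Y Z) X + g (br Z X) Y"
proof -
  have bl: "bilinear g" and sy: "\<And>X Y. g X Y = g Y X"
    using g by (auto simp: inner_product_def)
  have t: "br X Y = N X Y - N Y X" for X Y
    using N by (simp add: is_levi_civita_def)
  have m: "g (N X Y) Z = - g (N X Z) Y" for X Y Z
    using N sy[of Y "N X Z"] by (simp add: is_levi_civita_def add_eq_0_iff2)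
  show ?thesis
    using m[of Y X Z] m[of X Y Z] m[of Z X Y] by (simp add: t bilinear_lsub[OF bl])
qed

lemma levi_civita_ex1:
  fixes br :: "'a::real_vector \<Rightarrow> 'a \<Rightarrow> 'a"
  assumes g: "inner_product g" and fd: "finite_dimensional TYPE('a)" and L: "lie_algebra br"
  shows "\<exists>!N. is_levi_civita br g N"
proof (rule ex_ex1I)
  have bl: "bilinear g" and sy: "\<And>X Y. g X Y = g Y X"
    using g by (auto simp: inner_product_def)
  have bb: "bilinear br" and alt: "br X X = 0" for X using L by (auto simp: lie_algebra_def)
  note B = bilinear_ladd[OF bl] bilinear_radd[OF bl] bilinear_lmul[OF bl] bilinear_rmul[OF bl]
    bilinear_ladd[OF bb] bilinear_radd[OF bb] bilinear_lmul[OF bb] bilinear_rmul[OF bb]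
  have anti: "br X Y = - br Y X" for X Y
    using alt[of "X + Y"] alt[of X] alt[of Y] by (simp add: B add_eq_0_iff2)
  define K where "K X Y Z = (g (br X Y) Z - g (br Y Z) X + g (br Z X) Y) / 2" for X Y Z
  have K: "linear (K X Y)" for X Y
    by (rule linearI) (simp_all add: K_def B field_simps)
  define N where "N X Y = (THE W. \<forall>Z. g W Z = K X Y Z)" for X Y
  have N: "g (N X Y) Z = K X Y Z" for X Y Z
    using theI'[OF riesz_exists[OF g fd K[of X Y]]] unfolding N_def by blast
  have "bilinear N"
    unfolding bilinear_def
    by (intro conjI allI linearI; rule inner_product_eqI[OF g])
      (simp_all add: B N, simp_all add: K_def B field_simps)
  moreover have "N X Y - N Y X = br X Y" for X Y
  proof (rule inner_product_eqI[OF g])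
    fix Z
    show "g (N X Y - N Y X) Z = g (br X Y) Z"
      by (simp add: bilinear_lsub[OF bl] N K_def anti[of Y X] anti[of Z Y] anti[of Z X]
          bilinear_lneg[OF bl] field_simps)
  qed
  moreover have "g (N X Y) Z + g Y (N X Z) = 0" for X Y Z
    by (simp add: sy[of Y "N X Z"] N K_def anti[of Y X] anti[of Z Y] anti[of Z X]
          bilinear_lneg[OF bl] field_simps)
  ultimately have "is_levi_civita br g N" by (simp add: is_levi_civita_def)
  then show "\<exists>N. is_levi_civita br g N" by blast
next
  fix N M assume NM: "is_levi_civita br g N" "is_levi_civita br g M"
  show "N = M"
  proof (intro ext inner_product_eqI[OF g])
    fix X Y Z
    show "g (N X Y) Z = g (M X Y) Z"
      using levi_civita_koszul[OF g NM(1), of X Y Z] levi_civita_koszul[OF g NM(2), of X Y Z] by simp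
  qed
qed

lemma ricci_operator_spec:
  fixes br :: "'a::real_vector \<Rightarrow> 'a \<Rightarrow> 'a"
  assumes g: "inner_product g" and fd: "finite_dimensional TYPE('a)" and L: "lie_algebra br"
  shows "g (ricci_operator br g Y) Z = ricci_tensor br g Y Z"
proof -
  let ?E = "extend_basis {} :: 'a set"
  have E: "finite ?E" "independent ?E" "span ?E = UNIV"
    using finite_extend_basis_empty[OF fd] independent_extend_basis[of "{}::'a set"] independent_empty
    by auto
  interpret r: linear "\<lambda>v. representation ?E v b" for b
    using linear_representation[OF E(2,3)] by (simp add: linear_def real_scaleR_def[abs_def])
  have N: "bilinear (levi_civita br g)"
    using theI'[OF levi_civita_ex1[OF g fd L]] by (simp add: levi_civita_def is_levi_civita_def)
  have "linear (ricci_tensor br g Y)"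
    by (rule linearI)
      (simp_all add: ricci_tensor_def endo_trace_def curvature_def Let_def r.add r.diff r.scaleR
        bilinear_radd[OF N] bilinear_rmul[OF N] sum.distrib sum_subtractf sum_distrib_left
        algebra_simps)
  from theI'[OF riesz_exists[OF g fd this]] show ?thesis
    unfolding ricci_operator_def by blast
qed

end

theory Submission
  imports Defs
begin

text \<open>
  Let \<open>\<phi>\<close> be symmetric and ad-invariant. If \<open>D\<close> is a derivation of the Lie algebra, then
  \<open>X \<mapsto> \<phi> (D X)\<close> is a derivation into the dual, with symmetric part half of
  \<open>\<phi> (D X) Y + \<phi> X (D Y)\<close>. So it suffices to invert this operator on ad-invariant forms, and
  in an eigenbasis of the soliton derivation \<open>D\<close>, which is symmetric as \<open>ric\<close> is, it is division
  by the sums of two eigenvalues, provided that these do not vanish.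

  All eigenvalues of \<open>D\<close> are in fact positive when the algebra is not abelian. From
  \<open>tr (ric \<circ> F) = \<langle>F \<cdot> br, br\<rangle> / 4\<close> with \<open>F = id\<close> and \<open>F = D\<close> one gets \<open>c < 0\<close>. Let
  \<open>D X = d X\<close>. If \<open>X\<close> is central, \<open>ric X X \<ge> 0\<close> gives \<open>d \<ge> - c\<close>. Otherwise put \<open>A = ad X\<close>;
  taking \<open>F = [A, A\<^sup>*]\<close> yields \<open>d \<bar>A\<bar>\<^sup>2 = \<bar>A\<^sup>* \<cdot> br\<bar>\<^sup>2 / 4\<close>, and \<open>A\<^sup>*\<close> is not a
  derivation, since otherwise \<open>A\<^sup>* A\<close> would be nilpotent, whence \<open>\<bar>A\<bar>\<^sup>2 = tr (A\<^sup>* A) = 0\<close>.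
\<close>

section \<open>Traces of strictly filtered endomorphisms\<close>

text \<open>A basis adapted to the filtration makes the matrix of \<open>f\<close> strictly
  triangular. It is built from the bottom: the induction on \<open>j\<close> extends a basis of
  \<open>V (K - j)\<close> to one of the next larger term and keeps the diagonal entries
  zero.\<close>

lemma endo_trace_strict_filtration:
  fixes f :: "'a::real_vector \<Rightarrow> 'a" and V :: "nat \<Rightarrow> 'a set"
  assumes fd: "finite_dimensional TYPE('a)" and f: "linear f"
    and sub: "\<And>k. subspace (V k)" and V0: "V 0 = UNIV" and VK: "V K = {0}"
    and dec: "\<And>k. V (Suc k) \<subseteq> V k" and fV: "\<And>k X. X \<in> V k \<Longrightarrow> f X \<in> V (Suc k)"
  shows "endo_trace f = 0"
proof -
  have "\<exists>B. independent B \<and> span B = V (K - j) \<and> (\<forall>b\<in>B. representation B (f b) b = 0)"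
    if "j \<le> K" for j
    using that
  proof (induction j)
    case 0
    then show ?case using VK by (intro exI[of _ "{}"]) (simp add: independent_empty)
  next
    case (Suc j)
    let ?W = "V (K - Suc j)"
    have k: "Suc (K - Suc j) = K - j" using Suc.prems by simp
    from Suc obtain B where B: "independent B" "span B = V (K - j)"
      "\<And>b. b \<in> B \<Longrightarrow> representation B (f b) b = 0" by auto
    have "B \<subseteq> ?W" using span_superset[of B] B(2) dec[of "K - Suc j"] k by auto
    then obtain C where C: "B \<subseteq> C" "C \<subseteq> ?W" "independent C" "?W \<subseteq> span C"
      using maximal_independent_subset_extend[OF _ B(1)] by metis
    have "span C = ?W" using C(2,4) span_minimal[OF C(2) sub] by auto
    moreover have "representation C (f b) b = 0" if "b \<in> C" for b
    proof -
      \<comment> \<open>\<open>f\<close> maps the larger term into the span of the old basis, so the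
        coefficient of \<open>f b\<close> at a new basis vector is zero and at an old one is
        unchanged.\<close>
      have "f b \<in> span B" using fV[of b "K - Suc j"] that C(2) k B(2) by auto
      then have "representation C (f b) b = representation B (f b) b"
        by (simp add: representation_extend[OF C(3) _ C(1)])
      also have "\<dots> = 0"
        using B(3)[of b] representation_ne_zero[of B "f b" b] by (cases "b \<in> B") auto
      finally show ?thesis .
    qed
    ultimately show ?case using C(3) by blast
  qed
  from this[of K] obtain B where B: "independent B" "span B = UNIV"
    "\<And>b. b \<in> B \<Longrightarrow> representation B (f b) b = 0" using V0 by auto
  obtain T :: "'a set" where "finite T" "span T = UNIV"
    using fd by (auto simp: finite_dimensional_def)
  then have "finite B" using independent_span_bound[of T B] B(1) by auto
  then show ?thesis using endo_trace_eq[OF f _ B(1,2)] B(3) by simp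
qed

section \<open>Derivations and the lower central series\<close>

lemma lower_central_series_subspace: "subspace (lower_central_series br k)"
  by (cases k) simp_all

lemma lower_central_series_br:
  "Y \<in> lower_central_series br k \<Longrightarrow> br X Y \<in> lower_central_series br (Suc k)"
  by (auto intro!: span_base)

lemma lower_central_series_decreasing:
  "lower_central_series br (Suc k) \<subseteq> lower_central_series br k"
proof (induction k)
  case (Suc k)
  have "{br X Y |X Y. Y \<in> lower_central_series br (Suc k)}
      \<subseteq> {br X Y |X Y. Y \<in> lower_central_series br k}"
    using Suc by auto
  then show ?case
    by (subst (1 2) lower_central_series.simps(2)) (rule span_mono)
qed simp

lemma lower_central_series_derivation:
  assumes d: "lie_derivation br d"
  shows "X \<in> lower_central_series br k \<Longrightarrow> d X \<in> lower_central_series br k"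
proof (induction k arbitrary: X)
  case (Suc k)
  interpret d: linear d using d by (simp add: lie_derivation_def)
  let ?C = "lower_central_series br (Suc k)"
  have "X \<in> span {br X Y |X Y. Y \<in> lower_central_series br k}" using Suc.prems by simp
  then show ?case
  proof (induction rule: span_induct_alt)
    case base
    then show ?case using subspace_0[OF lower_central_series_subspace[of br "Suc k"]]
      by (simp only: d.zero)
  next
    case (step c x y)
    then obtain X Y where x: "x = br X Y" "Y \<in> lower_central_series br k" by auto
    have "d x = br (d X) Y + br X (d Y)" using d x by (simp add: lie_derivation_def)
    moreover have "br (d X) Y \<in> ?C" "br X (d Y) \<in> ?C"
      using lower_central_series_br[of _ br k] x Suc.IH by blast+
    ultimately have "d x \<in> ?C"
      using subspace_add[OF lower_central_series_subspace] by metis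
    then show ?case
      using step(2) subspace_add[OF lower_central_series_subspace]
        subspace_scale[OF lower_central_series_subspace] by (metis d.add d.scaleR)
  qed
qed simp

lemma lie_derivation_ad:
  assumes "lie_algebra br"
  shows "lie_derivation br (br X)"
proof -
  have bb: "bilinear br" and alt: "br X X = 0"
    and jac: "br X (br Y Z) + br Y (br Z X) + br Z (br X Y) = 0" for X Y Z
    using assms by (auto simp: lie_algebra_def)
  have anti: "br X Y = - br Y X" for X Y
    using alt[of "X + Y"] alt[of X] alt[of Y]
    by (simp add: bilinear_ladd[OF bb] bilinear_radd[OF bb] add_eq_0_iff2)
  have "br X (br Y Z) = br (br X Y) Z + br Y (br X Z)" for Y Z
    using jac[of X Y Z] anti[of Z X] anti[of Z "br X Y"]
    by (simp add: bilinear_rneg[OF bb] add_eq_0_iff2 algebra_simps)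
  then show ?thesis using bb by (simp add: lie_derivation_def bilinear_def)
qed

text \<open>\<open>br X\<close> moves each term of the lower central series into the next, and
  \<open>d\<close> preserves every term. Two choices of \<open>d\<close> matter later:
  \<open>br Z\<close>, which makes the Killing form vanish, and the metric adjoint of
  \<open>br X\<close>.\<close>

lemma endo_trace_derivation_ad:
  fixes br :: "'a::real_vector \<Rightarrow> 'a \<Rightarrow> 'a"
  assumes fd: "finite_dimensional TYPE('a)" and nil: "nilpotent_lie_algebra br"
    and d: "lie_derivation br d"
  shows "endo_trace (\<lambda>Y. d (br X Y)) = 0"
proof -
  obtain K where K: "lower_central_series br K = {0}"
    using nil by (auto simp: nilpotent_lie_algebra_def)
  have "linear d" "linear (br X)"
    using d nil by (auto simp: lie_derivation_def nilpotent_lie_algebra_def lie_algebra_def bilinear_def)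
  then have "linear (\<lambda>Y. d (br X Y))" using linear_compose[of "br X" d] by (simp add: o_def)
  then show ?thesis
    by (rule endo_trace_strict_filtration[where V = "lower_central_series br",
          OF fd _ lower_central_series_subspace _ K lower_central_series_decreasing])
      (simp, rule lower_central_series_derivation[OF d], rule lower_central_series_br)
qed

lemma endo_trace_ad:
  fixes br :: "'a::real_vector \<Rightarrow> 'a \<Rightarrow> 'a"
  assumes fd: "finite_dimensional TYPE('a)" and nil: "nilpotent_lie_algebra br"
  shows "endo_trace (br X) = 0"
proof -
  obtain K where K: "lower_central_series br K = {0}"
    using nil by (auto simp: nilpotent_lie_algebra_def)
  have "linear (br X)"
    using nil by (auto simp: nilpotent_lie_algebra_def lie_algebra_def bilinear_def)
  then show ?thesis
    by (rule endo_trace_strict_filtration[where V = "lower_central_series br",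
          OF fd _ lower_central_series_subspace _ K lower_central_series_decreasing])
      (simp, rule lower_central_series_br)
qed

section \<open>Orthonormal frames\<close>

text \<open>The frame is a parameter, so that with the same \<open>g\<close> the locale can be
  interpreted again at an eigenbasis of a symmetric endomorphism.\<close>

locale orthonormal_frame =
  fixes g :: "'a::real_vector \<Rightarrow> 'a \<Rightarrow> real" and E :: "'a set"
  assumes g: "inner_product g" and finE: "finite E" and indE: "independent E"
    and spanE: "span E = UNIV"
    and orthonormal: "\<And>e f. e \<in> E \<Longrightarrow> f \<in> E \<Longrightarrow> g e f = (if e = f then 1 else 0)"
    and expansion: "\<And>X. (\<Sum>e\<in>E. g X e *\<^sub>R e) = X"
begin

lemma bilinear_g: "bilinear g" using g by (simp add: inner_product_def)

lemma g_sym: "g X Y = g Y X" using g by (simp add: inner_product_def)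

lemma g_pos: "X \<noteq> 0 \<Longrightarrow> g X X > 0" using g by (simp add: inner_product_def)

lemma g_nonneg: "g X X \<ge> 0"
  using g_pos[of X] bilinear_lzero[OF bilinear_g, of X] by (cases "X = 0") auto

lemma g_eq_0_iff: "g X X = 0 \<longleftrightarrow> X = 0"
  using g_pos[of X] bilinear_lzero[OF bilinear_g, of X] by (cases "X = 0") auto

sublocale gl: linear "\<lambda>X. g X Y" for Y using bilinear_g by (simp add: bilinear_def)

sublocale gr: linear "\<lambda>Y. g X Y" for X using bilinear_g by (simp add: bilinear_def)

lemmas g_simps = gl.add gl.diff gl.neg gl.scaleR gr.add gr.diff gr.neg gr.scaleR

lemma parseval: "g X Y = (\<Sum>e\<in>E. g X e * g Y e)"
proof -
  have "g X Y = g (\<Sum>e\<in>E. g X e *\<^sub>R e) Y" by (simp add: expansion)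
  also have "\<dots> = (\<Sum>e\<in>E. g X e * g e Y)" by (simp only: gl.sum gl.scaleR real_scaleR_def)
  finally show ?thesis by (simp add: g_sym[of _ Y])
qed

lemma linear_expansion:
  assumes "linear f"
  shows "f X = (\<Sum>e\<in>E. g X e *\<^sub>R f e)"
proof -
  interpret f: linear f by fact
  have "f X = f (\<Sum>e\<in>E. g X e *\<^sub>R e)" by (simp add: expansion)
  then show ?thesis by (simp only: f.sum f.scaleR)
qed

section \<open>Trace and metric adjoint\<close>

definition tr :: "('a \<Rightarrow> 'a) \<Rightarrow> real" where
  "tr f = (\<Sum>e\<in>E. g (f e) e)"

lemma endo_trace_eq_tr:
  assumes "linear f"
  shows "endo_trace f = tr f"
proof -
  interpret r: linear "\<lambda>v. representation E v b" for b
    using linear_representation[OF indE spanE] by (simp add: linear_def real_scaleR_def[abs_def])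
  have "representation E v b = g v b" if b: "b \<in> E" for v b
  proof -
    have "representation E v b = representation E (\<Sum>e\<in>E. g v e *\<^sub>R e) b" by (simp add: expansion)
    also have "\<dots> = (\<Sum>e\<in>E. g v e * representation E e b)"
      by (simp only: r.sum r.scaleR real_scaleR_def)
    also have "\<dots> = (\<Sum>e\<in>E. if e = b then g v e else 0)"
      by (intro sum.cong) (auto simp: representation_basis[OF indE])
    finally show ?thesis using b finE by simp
  qed
  then show ?thesis by (simp add: endo_trace_eq[OF assms finE indE spanE] tr_def)
qed

lemma finite_dim: "finite_dimensional TYPE('a)"
  using finE spanE by (auto simp: finite_dimensional_def)

lemma tr_swap:
  assumes f: "linear f" and h: "linear h"
  shows "tr (\<lambda>X. f (h X)) = tr (\<lambda>X. h (f X))"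
proof -
  have "tr (\<lambda>X. p (q X)) = (\<Sum>e\<in>E. \<Sum>k\<in>E. g (q e) k * g (p k) e)" if "linear p" for p q
  proof -
    have "g (p (q e)) e = (\<Sum>k\<in>E. g (q e) k * g (p k) e)" for e
      by (subst linear_expansion[OF that, of "q e"]) (simp only: gl.sum gl.scaleR real_scaleR_def)
    then show ?thesis by (simp add: tr_def)
  qed
  note * = this[OF f, of h] this[OF h, of f]
  show ?thesis unfolding * by (subst sum.swap) (simp add: mult.commute)
qed

definition adj :: "('a \<Rightarrow> 'a) \<Rightarrow> 'a \<Rightarrow> 'a" where
  "adj f Y = (\<Sum>e\<in>E. g Y (f e) *\<^sub>R e)"

lemma linear_adj: "linear (adj f)"
  by (rule linearI)
    (simp_all add: adj_def g_simps scaleR_add_left sum.distrib scaleR_sum_right)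

lemma g_adj:
  assumes "linear f"
  shows "g (adj f Y) X = g Y (f X)"
proof -
  have "g (adj f Y) X = (\<Sum>e\<in>E. g Y (f e) * g e X)"
    unfolding adj_def by (simp only: gl.sum gl.scaleR real_scaleR_def)
  also have "\<dots> = g Y (\<Sum>e\<in>E. g X e *\<^sub>R f e)"
    by (simp only: gr.sum gr.scaleR real_scaleR_def) (simp add: g_sym[of X] mult.commute)
  finally show ?thesis by (simp flip: linear_expansion[OF assms])
qed

text \<open>Expanded in the frame, both sides are the same double sum over matrix entries of
  \<open>f\<close>, with the indices exchanged. In \<open>sum_ricci_tensor_commutator\<close> this
  moves a derivation across the inner product, one argument of the bracket at a time.\<close>

lemma sum_adj:
  assumes F: "bilinear F" and f: "linear f"
  shows "(\<Sum>e\<in>E. F (f e) e) = (\<Sum>e\<in>E. F e (adj f e) :: real)"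
proof -
  interpret Fl: linear "\<lambda>X. F X Y" for Y using F by (simp add: bilinear_def)
  interpret Fr: linear "\<lambda>Y. F X Y" for X using F by (simp add: bilinear_def)
  have 1: "F (f e) e = (\<Sum>k\<in>E. g (f e) k * F k e)" for e
    using linear_expansion[OF Fl.linear_axioms[of e], of "f e"] by simp
  have 2: "F e (adj f e) = (\<Sum>k\<in>E. g (f k) e * F e k)" for e
    using linear_expansion[OF Fr.linear_axioms[of e], of "adj f e"]
    by (simp add: g_adj[OF f] g_sym[of e])
  show ?thesis unfolding 1 2 by (rule sum.swap)
qed

lemma sum_skew:
  fixes s m :: "'a \<Rightarrow> 'a \<Rightarrow> real"
  assumes "\<And>e f. s e f = s f e" "\<And>e f. m e f = - m f e"
  shows "(\<Sum>e\<in>E. \<Sum>f\<in>E. s e f * m e f) = 0"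
proof -
  have "(\<Sum>e\<in>E. \<Sum>f\<in>E. s e f * m e f) = (\<Sum>f\<in>E. \<Sum>e\<in>E. s e f * m e f)" by (rule sum.swap)
  also have "\<dots> = (\<Sum>f\<in>E. \<Sum>e\<in>E. - (s f e * m f e))"
    using assms
    by (intro sum.cong refl) (metis mult_minus_right)
  finally show ?thesis by (simp add: sum_negf)
qed

lemma bilinear_eqI:
  assumes "bilinear F" "bilinear G" "\<And>e f. e \<in> E \<Longrightarrow> f \<in> E \<Longrightarrow> F e f = G e f"
  shows "F X Y = G X Y"
  using bilinear_eq[OF assms(1,2), of UNIV E UNIV E] assms(3) spanE by auto

lemma trilinear_zero:
  fixes T :: "'a \<Rightarrow> 'a \<Rightarrow> 'a \<Rightarrow> real"
  assumes T1: "\<And>Y Z. linear (\<lambda>X. T X Y Z)" and T2: "\<And>X. bilinear (T X)"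
    and 0: "\<And>e f h. e \<in> E \<Longrightarrow> f \<in> E \<Longrightarrow> h \<in> E \<Longrightarrow> T e f h = 0"
  shows "T X Y Z = 0"
proof -
  have "bilinear (\<lambda>X Y. 0 :: real)" by (simp add: bilinear_def linear_iff)
  then have "T e Y Z = 0" if "e \<in> E" for e Y Z
    using bilinear_eqI[OF T2[of e], of "\<lambda>X Y. 0"] 0 that by blast
  then show ?thesis using linear_expansion[OF T1[of Y Z], of X] by simp
qed

section \<open>Spectral theorem for symmetric endomorphisms\<close>

text \<open>A maximizer of \<open>g (D Y) Y\<close> over the unit vectors of the orthogonal
  complement \<open>W\<close> of \<open>B\<close> is an eigenvector. The vector space carries no
  topology, so compactness is obtained for coordinate functions \<open>u\<close>.\<close>

lemma maximal_eigenvector: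
  assumes D: "linear D" and sym: "\<And>X Y. g (D X) Y = g X (D Y)"
    and B: "\<And>b. b \<in> B \<Longrightarrow> \<exists>r. D b = r *\<^sub>R b"
    and X: "X \<noteq> 0" "\<And>b. b \<in> B \<Longrightarrow> g X b = 0"
  obtains v r where "g v v = 1" "\<And>b. b \<in> B \<Longrightarrow> g v b = 0" "D v = r *\<^sub>R v"
proof -
  interpret D: linear D by fact
  define W where "W = {Y. \<forall>b\<in>B. g Y b = 0}"
  define vec where "vec u = (\<Sum>e\<in>E. u e *\<^sub>R e)" for u :: "'a \<Rightarrow> real"
  \<comment> \<open>Coordinates are pinned to zero outside \<open>E\<close>, so that every factor is
    compact and Tychonoff applies.\<close>
  define P where "P = (\<Pi>\<^sub>E e\<in>UNIV. if e \<in> E then {-1..1::real} else {0})"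
  define C where "C = {u. (\<Sum>e\<in>E. u e * u e) = 1} \<inter> (\<Inter>b\<in>B. {u. (\<Sum>e\<in>E. u e * g e b) = 0})"
  define q where "q u = (\<Sum>e\<in>E. \<Sum>f\<in>E. u e * u f * g (D e) f)" for u
  have coord: "continuous_on S (\<lambda>u. u e :: real)" for S and e :: 'a
    by (rule continuous_on_subset[OF continuous_on_product_coordinates subset_UNIV])
  have "compactin euclidean (if e \<in> E then {-1..1::real} else {0})" for e by simp
  then have "compactin (product_topology (\<lambda>e::'a. euclidean) UNIV) P"
    unfolding P_def compactin_PiE by blast
  then have P: "compact P" by (simp add: euclidean_product_topology)
  have C: "closed C" unfolding C_def
    by (intro closed_Int closed_INT ballI closed_Collect_eq continuous_intros coord)
  have vec_g: "g (vec u) b = (\<Sum>e\<in>E. u e * g e b)" for u b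
    unfolding vec_def by (simp only: gl.sum gl.scaleR real_scaleR_def)
  have vec_E: "g (vec u) f = u f" if "f \<in> E" for u f
  proof -
    have "g (vec u) f = (\<Sum>e\<in>E. if e = f then u e else 0)"
      unfolding vec_g using that by (intro sum.cong) (auto simp: orthonormal)
    then show ?thesis using that finE by simp
  qed
  have norm: "g (vec u) (vec u) = (\<Sum>e\<in>E. u e * u e)" for u
    by (subst parseval) (simp add: vec_E)
  have qv: "q u = g (D (vec u)) (vec u)" for u
  proof -
    have "g (D (vec u)) (vec u) = (\<Sum>e\<in>E. u e * g (D e) (vec u))"
      unfolding vec_def[of u] by (simp only: D.sum D.scaleR gl.sum gl.scaleR real_scaleR_def)
    also have "\<dots> = (\<Sum>e\<in>E. u e * (\<Sum>f\<in>E. u f * g (D e) f))"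
      unfolding vec_def by (simp only: gr.sum gr.scaleR real_scaleR_def)
    finally show ?thesis by (simp add: q_def sum_distrib_left mult.assoc)
  qed
  have unit: "\<exists>u\<in>P \<inter> C. vec u = Y" if Y: "Y \<in> W" "g Y Y = 1" for Y
  proof -
    define u where "u e = (if e \<in> E then g Y e else 0)" for e
    have "vec u = (\<Sum>e\<in>E. g Y e *\<^sub>R e)"
      unfolding vec_def u_def by (intro sum.cong) auto
    then have vu: "vec u = Y" by (simp add: expansion)
    have n: "(\<Sum>e\<in>E. u e * u e) = 1" using norm[of u] Y(2) vu by simp
    have "u e * u e \<le> 1" if "e \<in> E" for e
      using member_le_sum[OF that, of "\<lambda>e. u e * u e"] finE n by simp
    then have "u e \<in> {-1..1}" if "e \<in> E" for e
      using that by (simp add: abs_square_le_1[unfolded power2_eq_square] abs_le_iff)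
    then have "u \<in> P" by (auto simp: P_def u_def)
    moreover have "u \<in> C" using n Y(1) vec_g[of u] vu by (simp add: C_def W_def)
    ultimately show ?thesis using vu by blast
  qed
  have scale: "(1 / sqrt (g Y Y)) *\<^sub>R Y \<in> W"
    "g ((1 / sqrt (g Y Y)) *\<^sub>R Y) ((1 / sqrt (g Y Y)) *\<^sub>R Y) = 1"
    if "Y \<in> W" "Y \<noteq> 0" for Y
    using that g_pos[of Y] by (auto simp: W_def g_simps)
  have "X \<in> W" using X by (simp add: W_def)
  then have "P \<inter> C \<noteq> {}" using unit scale X(1) by blast
  moreover have "continuous_on (P \<inter> C) q"
    unfolding q_def by (intro continuous_intros coord)
  ultimately obtain u where u: "u \<in> P \<inter> C" "\<And>u'. u' \<in> P \<inter> C \<Longrightarrow> q u' \<le> q u"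
    using continuous_attains_sup[OF compact_Int_closed[OF P C]] by metis
  define v where "v = vec u"
  define M where "M = g (D v) v"
  have v: "g v v = 1" "v \<in> W" using u(1) norm vec_g by (auto simp: v_def C_def W_def)
  \<comment> \<open>By homogeneity the bound on unit vectors holds on all of
    \<open>W\<close>.\<close>
  have max: "g (D Y) Y \<le> M * g Y Y" if Y: "Y \<in> W" for Y
  proof (cases "Y = 0")
    case False
    define r where "r = 1 / sqrt (g Y Y)"
    have r: "r * r * g Y Y = 1" using g_pos[OF False] by (simp add: r_def)
    obtain u' where "u' \<in> P \<inter> C" "vec u' = r *\<^sub>R Y"
      using unit scale[OF Y False] unfolding r_def by blast
    then have "r * r * g (D Y) Y \<le> M * (r * r * g Y Y)"
      using u(2)[of u'] unfolding r by (simp add: qv v_def M_def D.scaleR g_simps mult.assoc)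
    then have "r * r * g (D Y) Y \<le> r * r * (M * g Y Y)" by (simp add: algebra_simps)
    moreover have "r * r > 0" using g_pos[OF False] by (simp add: r_def)
    ultimately show ?thesis by (metis mult_le_cancel_left_pos)
  qed (simp add: D.zero g_simps)
  \<comment> \<open>The residual of the eigenvalue equation; it stays in \<open>W\<close> because
    \<open>D\<close> is symmetric and scales every element of \<open>B\<close>.\<close>
  define w where "w = D v - M *\<^sub>R v"
  have "g (D v) b = 0" if "b \<in> B" for b
    using B[OF that] v(2) that by (auto simp: sym W_def g_simps)
  then have w: "w \<in> W" using v(2) by (simp add: W_def w_def g_simps)
  define p where "p = g w w"
  define K where "K = M * p - g (D w) w"
  have K: "K \<ge> 0" using max[OF w] by (simp add: K_def p_def)
  \<comment> \<open>Maximality is tested along the line through \<open>v\<close> in direction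
    \<open>w\<close>; a nonzero \<open>p\<close> would let the term linear in \<open>t\<close> win
    for small positive \<open>t\<close>.\<close>
  have t: "2 * t * p \<le> t * t * K" for t
  proof -
    have "v + t *\<^sub>R w \<in> W" using v w by (simp add: W_def g_simps)
    note 1 = max[OF this]
    have 2: "g (D (v + t *\<^sub>R w)) (v + t *\<^sub>R w) = M + 2 * t * g (D v) w + t * t * g (D w) w"
      using sym[of w v] g_sym[of w "D v"]
      by (simp add: D.add D.scaleR g_simps M_def algebra_simps)
    have 3: "g (v + t *\<^sub>R w) (v + t *\<^sub>R w) = 1 + 2 * t * g v w + t * t * p"
      using g_sym[of w v] by (simp add: g_simps v p_def algebra_simps)
    have "p = g (D v) w - M * g v w" unfolding p_def by (subst w_def) (simp add: g_simps)
    then have 4: "g (D v) w = p + M * g v w" by simp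
    show ?thesis using 1 unfolding 2 3 4 by (simp add: K_def algebra_simps)
  qed
  \<comment> \<open>The value of \<open>t\<close> that is inserted; adding 1 keeps the denominator
    positive even if \<open>K = 0\<close>.\<close>
  define s where "s = p / (K + 1)"
  have s: "p = s * (K + 1)" using K by (simp add: s_def)
  have "s * s * (K + 2) \<le> 0" using t[of s] by (simp add: s algebra_simps)
  then have "s * s \<le> 0" using K by (simp add: mult_le_0_iff)
  then have "s = 0" by (auto simp: mult_le_0_iff)
  then have "w = 0" using s g_eq_0_iff[of w] by (simp add: p_def)
  then have "D v = M *\<^sub>R v" by (simp add: w_def)
  then show thesis using that[of v M] v by (simp add: W_def)
qed

text \<open>An orthonormal set of eigenvectors of greatest cardinality, which exists because
  \<open>card E\<close> is a bound, must span: otherwise the nonzero residual \<open>Y\<close> of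
  some expansion lets \<open>maximal_eigenvector\<close> enlarge it.\<close>

lemma spectral_theorem:
  assumes D: "linear D" and sym: "\<And>X Y. g (D X) Y = g X (D Y)"
  obtains B d where "orthonormal_frame g B" "\<And>b. b \<in> B \<Longrightarrow> D b = d b *\<^sub>R b"
proof -
  define Q where "Q B \<longleftrightarrow> finite B \<and> (\<forall>b\<in>B. \<forall>c\<in>B. g b c = (if b = c then 1 else 0)) \<and>
    (\<forall>b\<in>B. \<exists>r. D b = r *\<^sub>R b)" for B
  have coeff: "g (\<Sum>b\<in>B. u b *\<^sub>R b) c = u c" if "Q B" "c \<in> B" for B u c
  proof -
    have "g (\<Sum>b\<in>B. u b *\<^sub>R b) c = (\<Sum>b\<in>B. u b * g b c)"
      by (simp only: gl.sum gl.scaleR real_scaleR_def)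
    also have "\<dots> = (\<Sum>b\<in>B. if b = c then u b else 0)"
      using that by (intro sum.cong) (auto simp: Q_def)
    finally show ?thesis using that by (simp add: Q_def)
  qed
  have ind: "independent B" if "Q B" for B
  proof (rule independent_if_scalars_zero)
    show "finite B" using that by (simp add: Q_def)
    show "u c = 0" if "(\<Sum>b\<in>B. u b *\<^sub>R b) = 0" "c \<in> B" for u c
      using coeff[OF \<open>Q B\<close> that(2), of u] that(1) by (simp add: g_simps)
  qed
  have "\<forall>B. Q B \<longrightarrow> card B < Suc (card E)"
    using independent_span_bound[OF finE ind] spanE by (simp add: less_Suc_eq_le)
  moreover have "Q {}" by (simp add: Q_def)
  ultimately obtain B where B: "Q B" "\<And>C. Q C \<Longrightarrow> card C \<le> card B"
    using ex_has_greatest_nat[of Q "{}" card "Suc (card E)"] by metis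
  have expand: "(\<Sum>b\<in>B. g X b *\<^sub>R b) = X" for X
  proof (rule ccontr)
    define Y where "Y = X - (\<Sum>b\<in>B. g X b *\<^sub>R b)"
    assume "(\<Sum>b\<in>B. g X b *\<^sub>R b) \<noteq> X"
    then have "Y \<noteq> 0" unfolding Y_def right_minus_eq by (rule not_sym)
    moreover have "g Y b = 0" if "b \<in> B" for b
      using coeff[OF B(1) that] by (simp add: Y_def g_simps)
    ultimately obtain v r where v: "g v v = 1" "\<And>b. b \<in> B \<Longrightarrow> g v b = 0" "D v = r *\<^sub>R v"
      using maximal_eigenvector[OF D sym, of B Y] B(1) unfolding Q_def by metis
    have "v \<notin> B" using v(1,2) by force
    moreover have "g b v = 0" if "b \<in> B" for b using v(2)[OF that] by (simp add: g_sym)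
    then have "Q (insert v B)" using B(1) v \<open>v \<notin> B\<close> by (auto simp: Q_def)
    ultimately show False using B(2)[of "insert v B"] B(1) by (simp add: Q_def)
  qed
  have "span B = UNIV"
  proof -
    have "X \<in> span B" for X
      by (subst expand[symmetric, of X]) (intro span_sum span_scale span_base)
    then show ?thesis by auto
  qed
  then have "orthonormal_frame g B"
    using B(1) ind[OF B(1)] expand g by unfold_locales (auto simp: Q_def)
  moreover have "\<exists>d. \<forall>b\<in>B. D b = d b *\<^sub>R b"
    using B(1) by (intro bchoice) (simp add: Q_def)
  ultimately show thesis using that by blast
qed

end

section \<open>The Ricci tensor of a nilpotent metric Lie algebra\<close>

locale metric_nilpotent = orthonormal_frame +
  fixes br :: "'a \<Rightarrow> 'a \<Rightarrow> 'a"
  assumes nilpotent: "nilpotent_lie_algebra br"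
begin

lemma lie: "lie_algebra br" using nilpotent by (simp add: nilpotent_lie_algebra_def)

lemma bilinear_br: "bilinear br" using lie by (simp add: lie_algebra_def)

sublocale brl: linear "\<lambda>X. br X Y" for Y using bilinear_br by (simp add: bilinear_def)

sublocale brr: linear "br X" for X
  using bilinear_br by (simp add: bilinear_def)

lemma br_self: "br X X = 0" using lie by (simp add: lie_algebra_def)

lemma br_anti: "br X Y = - br Y X"
  using br_self[of "X + Y"] br_self[of X] br_self[of Y]
  by (simp add: brl.add brr.add add_eq_0_iff2)

lemma derivation_ad: "lie_derivation br (br X)" by (rule lie_derivation_ad[OF lie])

lemma tr_ad: "tr (br X) = 0"
  using endo_trace_ad[OF finite_dim nilpotent] endo_trace_eq_tr[OF brr.linear_axioms] by simp

lemma tr_derivation_ad: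
  assumes "lie_derivation br d"
  shows "tr (\<lambda>Y. d (br X Y)) = 0"
proof -
  have "linear (\<lambda>Y. d (br X Y))"
    using linear_compose[OF brr.linear_axioms[of X], of d] assms
    by (simp add: lie_derivation_def o_def)
  then show ?thesis
    using endo_trace_derivation_ad[OF finite_dim nilpotent assms, of X] endo_trace_eq_tr by simp
qed

lemma levi_civita: "is_levi_civita br g (levi_civita br g)"
  using theI'[OF levi_civita_ex1[OF g finite_dim lie]] by (simp add: levi_civita_def)

text \<open>
  With \<open>S\<^sub>Z X = \<nabla>\<^sub>X Z\<close>, vanishing of the torsion and of all \<open>tr (ad X)\<close> collapses the
  trace of the curvature to \<open>- tr (S\<^sub>Z S\<^sub>Y)\<close>.
\<close>

lemma ricci_tensor_shape:
  "ricci_tensor br g Y Z =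
     - (\<Sum>e\<in>E. g (levi_civita br g (levi_civita br g e Y) Z) e)"
proof -
  define N where "N = levi_civita br g"
  have LC: "is_levi_civita br g N" using levi_civita by (simp add: N_def)
  then have bN: "bilinear N" by (simp add: is_levi_civita_def)
  interpret Nl: linear "\<lambda>V. N V W" for W using bN by (simp add: bilinear_def)
  interpret Nr: linear "N W" for W using bN by (simp add: bilinear_def)
  have flip: "N X Y = N Y X + br X Y" for X Y
    using LC by (metis is_levi_civita_def diff_eq_eq add.commute)
  note koszul = levi_civita_koszul[OF g LC]
  have "linear (\<lambda>X. curvature br g X Y Z)"
    by (rule linearI)
      (simp_all add: curvature_def Let_def flip: N_def,
       simp_all add: Nl.add Nr.add Nl.scaleR Nr.scaleR brl.add brl.scaleR algebra_simps)
  then have 1: "ricci_tensor br g Y Z = (\<Sum>e\<in>E. g (N e (N Y Z)) e)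
      - (\<Sum>e\<in>E. g (N Y (N e Z)) e) - (\<Sum>e\<in>E. g (N (br e Y) Z) e)"
    by (simp add: ricci_tensor_def endo_trace_eq_tr tr_def curvature_def Let_def g_simps
        sum_subtractf flip: N_def)
  \<comment> \<open>By the Koszul formula the first sum is minus the trace of
    \<open>br (N Y Z)\<close>, which vanishes.\<close>
  have "g (N e W) e = - g (br W e) e" for e W
    using koszul[of e W e] br_anti[of e W] br_self[of e] by (simp add: g_simps)
  then have 2: "(\<Sum>e\<in>E. g (N e (N Y Z)) e) = 0"
    using tr_ad[of "N Y Z"] by (simp add: tr_def sum_negf)
  \<comment> \<open>Cyclicity of the trace brings the second sum into a form that torsion-freeness
    merges with the third.\<close>
  have 3: "(\<Sum>e\<in>E. g (N Y (N e Z)) e) = (\<Sum>e\<in>E. g (N (N Y e) Z) e)"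
    using tr_swap[OF Nr.linear_axioms[of Y] Nl.linear_axioms[of Z]] by (simp add: tr_def)
  have 4: "(\<Sum>e\<in>E. g (N (N e Y) Z) e)
      = (\<Sum>e\<in>E. g (N (N Y e) Z) e) + (\<Sum>e\<in>E. g (N (br e Y) Z) e)"
    unfolding flip[of _ Y] by (simp add: Nl.add g_simps sum.distrib)
  show ?thesis using 1 2 3 4 by (simp add: N_def)
qed

text \<open>In the frame, the map \<open>e \<mapsto> N e W\<close> has as symmetric part minus that
  of \<open>br W\<close>, and as skew part \<open>- m W / 2\<close>. In the trace of a product of
  two such maps the mixed terms cancel and the Killing form is zero, which leaves the two
  sums.\<close>

lemma ricci_tensor_eq:
  "ricci_tensor br g Y Z = (\<Sum>e\<in>E. \<Sum>f\<in>E. g (br e f) Y * g (br e f) Z) / 4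
     - (\<Sum>e\<in>E. g (br Y e) (br Z e)) / 2"
proof -
  define N where "N = levi_civita br g"
  have LC: "is_levi_civita br g N" using levi_civita by (simp add: N_def)
  then have bN: "bilinear N" by (simp add: is_levi_civita_def)
  interpret Nl: linear "\<lambda>V. N V W" for W using bN by (simp add: bilinear_def)
  define a where "a W e f = g (br W e) f" for W e f
  define m where "m W e f = g (br e f) W" for W e f
  have m_anti: "m W e f = - m W f e" for W e f
    unfolding m_def by (subst br_anti) (simp add: g_simps)
  have N: "g (N e W) f = (- a W e f - a W f e - m W e f) / 2" for W e f
    using levi_civita_koszul[OF g LC, of e W f] br_anti[of e W] br_anti[of f e]
    by (simp add: a_def m_def g_simps)
  \<comment> \<open>Transposition reverses the sign of the skew part only.\<close>
  have N': "g (N f W) e = (m W e f - a W e f - a W f e) / 2" for W e f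
    using N[of f W e] m_anti[of W f e] by simp
  have "(\<Sum>e\<in>E. g (N (N e Y) Z) e) = (\<Sum>e\<in>E. \<Sum>f\<in>E. g (N e Y) f * g (N f Z) e)"
    by (intro sum.cong refl, subst linear_expansion[OF Nl.linear_axioms[of Z]])
      (simp only: gl.sum gl.scaleR real_scaleR_def)
  also have "\<dots> = (\<Sum>e\<in>E. \<Sum>f\<in>E. (a Y e f * a Z e f + a Y f e * a Z f e
      + a Y e f * a Z f e + a Y f e * a Z e f - (a Y e f + a Y f e) * m Z e f
      + (a Z e f + a Z f e) * m Y e f - m Y e f * m Z e f) / 4)"
    unfolding N[of _ Y] N'[of _ Z] by (intro sum.cong refl) (simp add: algebra_simps add_divide_distrib diff_divide_distrib)
  also have "\<dots> = ((\<Sum>e\<in>E. \<Sum>f\<in>E. a Y e f * a Z e f) + (\<Sum>e\<in>E. \<Sum>f\<in>E. a Y f e * a Z f e)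
      + (\<Sum>e\<in>E. \<Sum>f\<in>E. a Y e f * a Z f e) + (\<Sum>e\<in>E. \<Sum>f\<in>E. a Y f e * a Z e f)
      - (\<Sum>e\<in>E. \<Sum>f\<in>E. (a Y e f + a Y f e) * m Z e f)
      + (\<Sum>e\<in>E. \<Sum>f\<in>E. (a Z e f + a Z f e) * m Y e f)
      - (\<Sum>e\<in>E. \<Sum>f\<in>E. m Y e f * m Z e f)) / 4"
    by (simp add: sum.distrib sum_subtractf flip: sum_divide_distrib)
  also have "(\<Sum>e\<in>E. \<Sum>f\<in>E. (a Y e f + a Y f e) * m Z e f) = 0"
    by (rule sum_skew) (rule add.commute, rule m_anti)
  also have "(\<Sum>e\<in>E. \<Sum>f\<in>E. (a Z e f + a Z f e) * m Y e f) = 0"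
    by (rule sum_skew) (rule add.commute, rule m_anti)
  also have "(\<Sum>e\<in>E. \<Sum>f\<in>E. a Y f e * a Z f e) = (\<Sum>e\<in>E. \<Sum>f\<in>E. a Y e f * a Z e f)"
    by (rule sum.swap)
  also have "(\<Sum>e\<in>E. \<Sum>f\<in>E. a Y f e * a Z e f) = (\<Sum>e\<in>E. \<Sum>f\<in>E. a Y e f * a Z f e)"
    by (rule sum.swap)
  \<comment> \<open>The remaining mixed product of \<open>a\<close> with its transpose is the
    Killing form.\<close>
  also have "(\<Sum>e\<in>E. \<Sum>f\<in>E. a Y e f * a Z f e) = tr (\<lambda>X. br Z (br Y X))"
  proof -
    have "g (br Z (br Y e)) e = (\<Sum>f\<in>E. a Y e f * a Z f e)" for e
      by (subst linear_expansion[OF brr.linear_axioms[of Z]])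
        (simp only: gl.sum gl.scaleR real_scaleR_def a_def)
    then show ?thesis by (simp add: tr_def)
  qed
  also have "\<dots> = 0" by (rule tr_derivation_ad[OF derivation_ad])
  also have "(\<Sum>e\<in>E. \<Sum>f\<in>E. a Y e f * a Z e f) = (\<Sum>e\<in>E. g (br Y e) (br Z e))"
    by (simp add: a_def flip: parseval)
  finally have "ricci_tensor br g Y Z = - ((2 * (\<Sum>e\<in>E. g (br Y e) (br Z e))
      - (\<Sum>e\<in>E. \<Sum>f\<in>E. m Y e f * m Z e f)) / 4)"
    by (simp add: ricci_tensor_shape flip: N_def)
  then show ?thesis by (simp add: m_def field_simps)
qed

text \<open>The infinitesimal action \<open>F \<cdot> br\<close> of an endomorphism on the bracket.\<close>

definition defect :: "('a \<Rightarrow> 'a) \<Rightarrow> 'a \<Rightarrow> 'a \<Rightarrow> 'a" where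
  "defect F X Y = F (br X Y) - br (F X) Y - br X (F Y)"

lemma bilinear_defect:
  assumes "linear F"
  shows "bilinear (defect F)"
proof -
  interpret F: linear F by fact
  show ?thesis
    unfolding bilinear_def
    by (intro conjI allI linearI)
      (simp_all add: defect_def F.add F.scaleR brl.add brr.add brl.scaleR brr.scaleR algebra_simps)
qed

lemma defect_derivation: "lie_derivation br F \<Longrightarrow> defect F X Y = 0"
  by (simp add: defect_def lie_derivation_def)

lemma derivation_if_defect:
  assumes F: "linear F" and 0: "\<And>e f. e \<in> E \<Longrightarrow> f \<in> E \<Longrightarrow> defect F e f = 0"
  shows "lie_derivation br F"
proof -
  have "bilinear (\<lambda>X Y. 0 :: 'a)" by (simp add: bilinear_def linear_iff)
  then have "defect F X Y = 0" for X Y using bilinear_eqI[OF bilinear_defect[OF F]] 0 by blast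
  then have "F (br X Y) = br (F X) Y + br X (F Y)" for X Y
    by (simp add: defect_def algebra_simps)
  then show ?thesis using F by (simp add: lie_derivation_def)
qed

text \<open>The moment map identity \<open>tr (ric \<circ> F) = \<langle>F \<cdot> br, br\<rangle> / 4\<close>.\<close>

lemma sum_ricci_tensor:
  assumes F: "linear F"
  shows "(\<Sum>k\<in>E. ricci_tensor br g (F k) k) =
    (\<Sum>e\<in>E. \<Sum>f\<in>E. g (defect F e f) (br e f)) / 4"
proof -
  interpret F: linear F by fact
  let ?P = "\<Sum>e\<in>E. \<Sum>f\<in>E. g (F (br e f)) (br e f)"
  let ?Q = "\<Sum>e\<in>E. \<Sum>f\<in>E. g (br (F e) f) (br e f)"
  have "(\<Sum>k\<in>E. \<Sum>e\<in>E. \<Sum>f\<in>E. g (br e f) (F k) * g (br e f) k) =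
      (\<Sum>e\<in>E. \<Sum>k\<in>E. \<Sum>f\<in>E. g (br e f) (F k) * g (br e f) k)"
    by (rule sum.swap)
  also have "\<dots> = (\<Sum>e\<in>E. \<Sum>f\<in>E. \<Sum>k\<in>E. g (br e f) (F k) * g (br e f) k)"
    by (rule sum.cong[OF refl]) (rule sum.swap)
  also have "\<dots> = ?P"
  proof (intro sum.cong refl)
    fix e f
    have "g (F (br e f)) (br e f) = (\<Sum>k\<in>E. g (br e f) k * g (F k) (br e f))"
      by (subst linear_expansion[OF F]) (simp only: gl.sum gl.scaleR real_scaleR_def)
    then show "(\<Sum>k\<in>E. g (br e f) (F k) * g (br e f) k) = g (F (br e f)) (br e f)"
      by (simp add: g_sym[of "br e f"] mult.commute)
  qed
  finally have P: "(\<Sum>k\<in>E. \<Sum>e\<in>E. \<Sum>f\<in>E. g (br e f) (F k) * g (br e f) k) = ?P" .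
  \<comment> \<open>By antisymmetry both argument slots of the bracket contribute equally, so half
    of \<open>?Q\<close> is a quarter of the two contributions together.\<close>
  have "(\<Sum>e\<in>E. \<Sum>f\<in>E. g (br e (F f)) (br e f)) = (\<Sum>f\<in>E. \<Sum>e\<in>E. g (br e (F f)) (br e f))"
    by (rule sum.swap)
  also have "\<dots> = ?Q"
    by (intro sum.cong refl, subst (1 2) br_anti) (simp add: g_simps)
  finally have Q: "(\<Sum>e\<in>E. \<Sum>f\<in>E. g (br e (F f)) (br e f)) = ?Q" .
  have "(\<Sum>k\<in>E. ricci_tensor br g (F k) k) = ?P / 4 - ?Q / 2"
    by (simp add: ricci_tensor_eq sum_subtractf P flip: sum_divide_distrib)
  also have "\<dots> = (?P - ?Q - (\<Sum>e\<in>E. \<Sum>f\<in>E. g (br e (F f)) (br e f))) / 4"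
    unfolding Q by simp
  also have "\<dots> = (\<Sum>e\<in>E. \<Sum>f\<in>E. g (defect F e f) (br e f)) / 4"
    by (simp add: defect_def g_simps sum_subtractf)
  finally show ?thesis .
qed

text \<open>
  If \<open>A\<close> is a derivation with adjoint \<open>A'\<close>, then \<open>[A, A'] \<cdot> br = A \<cdot> (A' \<cdot> br)\<close>, and the actions of
  \<open>A\<close> and \<open>A'\<close> on bilinear maps are adjoint to each other.
\<close>

lemma sum_ricci_tensor_commutator:
  assumes d: "lie_derivation br A"
  shows "(\<Sum>k\<in>E. ricci_tensor br g (A (adj A k) - adj A (A k)) k) =
    (\<Sum>e\<in>E. \<Sum>f\<in>E. g (defect (adj A) e f) (defect (adj A) e f)) / 4"
proof -
  define A' where "A' = adj A"
  define \<beta> where "\<beta> = defect A'"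
  have A: "linear A" and der: "A (br X Y) = br (A X) Y + br X (A Y)" for X Y
    using d by (auto simp: lie_derivation_def)
  have A': "linear A'" by (simp add: A'_def linear_adj)
  interpret A: linear A by fact
  interpret A': linear A' by fact
  have bil: "bilinear \<beta>" unfolding \<beta>_def by (rule bilinear_defect[OF A'])
  interpret bl: linear "\<lambda>V. \<beta> V W" for W using bil by (simp add: bilinear_def)
  interpret br': linear "\<beta> W" for W using bil by (simp add: bilinear_def)
  define F where "F X = A (A' X) - A' (A X)" for X
  have F: "linear F"
    by (rule linearI) (simp_all add: F_def A.add A'.add A.scaleR A'.scaleR algebra_simps)
  \<comment> \<open>The action respects commutators, and \<open>A\<close>, being a derivation,
    annihilates \<open>br\<close>.\<close>
  have 1: "defect F X Y = A (\<beta> X Y) - \<beta> (A X) Y - \<beta> X (A Y)" for X Y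
    by (simp add: F_def \<beta>_def defect_def der A.add A.diff A'.add A'.diff brl.diff brr.diff
        algebra_simps)
  have 2: "(\<Sum>e\<in>E. g (\<beta> (A e) f) (br e f)) = (\<Sum>e\<in>E. g (\<beta> e f) (br (A' e) f))" for f
    unfolding A'_def
    by (rule sum_adj[of "\<lambda>X Y. g (\<beta> X f) (br Y f)", OF _ A], unfold bilinear_def)
      (auto intro!: linearI simp: bl.add bl.scaleR brl.add brl.scaleR g_simps)
  have 3: "(\<Sum>f\<in>E. g (\<beta> e (A f)) (br e f)) = (\<Sum>f\<in>E. g (\<beta> e f) (br e (A' f)))" for e
    unfolding A'_def
    by (rule sum_adj[of "\<lambda>X Y. g (\<beta> e X) (br e Y)", OF _ A], unfold bilinear_def)
      (auto intro!: linearI simp: br'.add br'.scaleR brr.add brr.scaleR g_simps)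
  have 4: "g (A X) Y = g X (A' Y)" for X Y
    by (metis A'_def A g_adj g_sym)
  have "(\<Sum>e\<in>E. \<Sum>f\<in>E. g (defect F e f) (br e f))
    = (\<Sum>e\<in>E. \<Sum>f\<in>E. g (A (\<beta> e f)) (br e f)) - (\<Sum>e\<in>E. \<Sum>f\<in>E. g (\<beta> (A e) f) (br e f))
      - (\<Sum>e\<in>E. \<Sum>f\<in>E. g (\<beta> e (A f)) (br e f))"
    by (simp add: 1 g_simps sum_subtractf)
  also have "(\<Sum>e\<in>E. \<Sum>f\<in>E. g (\<beta> (A e) f) (br e f))
      = (\<Sum>e\<in>E. \<Sum>f\<in>E. g (\<beta> e f) (br (A' e) f))"
    by (subst (1 2) sum.swap) (simp add: 2)
  also have "(\<Sum>e\<in>E. \<Sum>f\<in>E. g (A (\<beta> e f)) (br e f)) - \<dots>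
      - (\<Sum>e\<in>E. \<Sum>f\<in>E. g (\<beta> e (A f)) (br e f)) = (\<Sum>e\<in>E. \<Sum>f\<in>E. g (\<beta> e f) (\<beta> e f))"
    \<comment> \<open>With every \<open>A\<close> moved across as \<open>A'\<close>, the terms on
      the bracket assemble into \<open>defect A'\<close>, which is \<open>\<beta>\<close>
      again.\<close>
    unfolding 3 4 by (subst (3) \<beta>_def) (simp add: defect_def g_simps sum_subtractf)
  finally show ?thesis
    using sum_ricci_tensor[OF F] unfolding F_def[abs_def] A'_def \<beta>_def by simp
qed

end

section \<open>Nilsolitons\<close>

text \<open>The abelian case is kept apart: there the Ricci operator is zero, so \<open>D\<close> is
  \<open>- c\<close> times the identity with \<open>c\<close> of any sign.\<close>

locale nilsoliton = metric_nilpotent +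
  fixes c :: real and D :: "'a \<Rightarrow> 'a"
  assumes derivation_D: "lie_derivation br D"
    and soliton: "\<And>X. ricci_operator br g X = c *\<^sub>R X + D X"
    and nonabelian: "\<exists>X Y. br X Y \<noteq> 0"
begin

sublocale D: linear D using derivation_D by (simp add: lie_derivation_def)

lemma ricci_tensor_soliton: "ricci_tensor br g X Y = c * g X Y + g (D X) Y"
  using ricci_operator_spec[OF g finite_dim lie, of X Y] by (simp add: soliton g_simps)

lemma D_sym: "g (D X) Y = g X (D Y)"
proof -
  have "ricci_tensor br g X Y = ricci_tensor br g Y X"
    by (simp add: ricci_tensor_eq mult.commute g_sym[of "br X _"])
  then show ?thesis by (simp add: ricci_tensor_soliton g_sym[of X])
qed

text \<open>The squared norm of the Ricci operator is \<open>c\<close> times its trace plus the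
  trace of its product with \<open>D\<close>. The latter is zero since \<open>D\<close> is a
  derivation, and the trace of Ricci is \<open>- m / 4\<close>. So \<open>c \<ge> 0\<close> would
  force Ricci, then \<open>m\<close>, then the bracket to vanish.\<close>

lemma c_neg: "c < 0"
proof (rule ccontr)
  assume c: "\<not> c < 0"
  define m where "m = (\<Sum>e\<in>E. \<Sum>f\<in>E. g (br e f) (br e f))"
  have ric: "(\<Sum>k\<in>E. ricci_tensor br g k k) = - m / 4"
    using sum_ricci_tensor[OF linear_id] by (simp add: defect_def m_def g_simps sum_negf)
  have m: "m \<ge> 0" unfolding m_def by (intro sum_nonneg g_nonneg)
  have "g (c *\<^sub>R k + D k) (c *\<^sub>R k + D k) =
      c * ricci_tensor br g k k + ricci_tensor br g (D k) k" for k
    using D_sym[of "D k" k] g_sym[of k "D k"]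
    by (simp add: ricci_tensor_soliton g_simps algebra_simps)
  then have "(\<Sum>k\<in>E. g (c *\<^sub>R k + D k) (c *\<^sub>R k + D k)) =
      c * (\<Sum>k\<in>E. ricci_tensor br g k k) + (\<Sum>k\<in>E. ricci_tensor br g (D k) k)"
    by (simp add: sum.distrib sum_distrib_left)
  also have "(\<Sum>k\<in>E. ricci_tensor br g (D k) k) = 0"
    using D.linear_axioms by (simp add: sum_ricci_tensor defect_derivation[OF derivation_D] g_simps)
  also have "c * (\<Sum>k\<in>E. ricci_tensor br g k k) + 0 \<le> 0" using c m by (simp add: ric)
  finally have "(\<Sum>k\<in>E. g (c *\<^sub>R k + D k) (c *\<^sub>R k + D k)) = 0"
    using sum_nonneg[of E "\<lambda>k. g (c *\<^sub>R k + D k) (c *\<^sub>R k + D k)"] g_nonneg by fastforce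
  then have "c *\<^sub>R k + D k = 0" if "k \<in> E" for k
    using that finE g_nonneg by (simp add: sum_nonneg_eq_0_iff g_eq_0_iff)
  then have "g (c *\<^sub>R k + D k) k = 0" if "k \<in> E" for k
    using that by (simp only: gl.zero)
  then have "ricci_tensor br g k k = 0" if "k \<in> E" for k
    using that by (simp add: ricci_tensor_soliton g_simps)
  then have "m = 0" using ric by simp
  then have "br e f = 0" if "e \<in> E" "f \<in> E" for e f
    using that finE g_nonneg
    by (simp add: m_def sum_nonneg_eq_0_iff sum_nonneg g_eq_0_iff)
  moreover have "bilinear (\<lambda>X Y. 0 :: 'a)" by (simp add: bilinear_def linear_iff)
  ultimately have "br X Y = 0" for X Y using bilinear_eqI[OF bilinear_br] by blast
  then show False using nonabelian by blast
qed

lemma adj_ad_not_derivation: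
  assumes "br X \<noteq> (\<lambda>Y. 0)"
  shows "(\<Sum>e\<in>E. g (br X e) (br X e)) > 0" "\<not> lie_derivation br (adj (br X))"
proof -
  let ?s = "\<Sum>e\<in>E. g (br X e) (br X e)"
  have "?s \<noteq> 0"
  proof
    assume "?s = 0"
    then have "br X e = 0" if "e \<in> E" for e
      using that finE g_nonneg by (simp add: sum_nonneg_eq_0_iff g_eq_0_iff)
    then have "br X Y = 0" for Y using linear_expansion[OF brr.linear_axioms, of X Y] by simp
    then show False using assms by auto
  qed
  moreover have "?s \<ge> 0" by (intro sum_nonneg g_nonneg)
  ultimately show pos: "?s > 0" by simp
  show "\<not> lie_derivation br (adj (br X))"
  proof
    assume "lie_derivation br (adj (br X))"
    from tr_derivation_ad[OF this] show False
      using pos by (simp add: tr_def g_adj[OF brr.linear_axioms])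
  qed
qed

lemma eigenvalue_pos:
  assumes X: "X \<noteq> 0" and eigen: "D X = d *\<^sub>R X"
  shows "d > 0"
proof (cases "br X = (\<lambda>Y. 0)")
  case True
  \<comment> \<open>For central \<open>X\<close> only the first, nonnegative sum of
    \<open>ricci_tensor_eq\<close> survives.\<close>
  have "ricci_tensor br g X X \<ge> 0"
    by (simp add: ricci_tensor_eq True g_simps sum_nonneg)
  then have "0 \<le> (c + d) * g X X" by (simp add: ricci_tensor_soliton eigen g_simps algebra_simps)
  then have "c + d \<ge> 0" using g_pos[OF X] by (simp add: zero_le_mult_iff)
  then show ?thesis using c_neg by simp
next
  case False
  define A where "A = br X"
  define A' where "A' = adj A"
  have A: "linear A" by (simp add: A_def brr.linear_axioms)
  have A': "linear A'" by (simp add: A'_def linear_adj)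
  interpret A: linear A by fact
  interpret A': linear A' by fact
  have swap: "tr (\<lambda>Y. A (A' Y)) = tr (\<lambda>Y. A' (A Y))" by (rule tr_swap[OF A A'])
  have DA': "linear (\<lambda>Y. D (A' Y))"
    using linear_compose[OF A' D.linear_axioms] by (simp add: o_def)
  have swap': "tr (\<lambda>Y. D (A' (A Y))) = tr (\<lambda>Y. A (D (A' Y)))" by (rule tr_swap[OF DA' A])
  \<comment> \<open>The commutator of \<open>D\<close> with \<open>br X\<close> is
    \<open>br (D X)\<close>, hence \<open>d\<close> times \<open>A\<close>.\<close>
  have der: "D (A Y) = d *\<^sub>R A Y + A (D Y)" for Y
    using derivation_D by (simp add: lie_derivation_def A_def eigen brl.scaleR)
  \<comment> \<open>The \<open>c\<close> terms cancel because a commutator has trace zero; by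
    \<open>der\<close> and cyclicity the \<open>D\<close> terms leave \<open>d\<close> times the
    trace of \<open>A'\<close> after \<open>A\<close>.\<close>
  have "(\<Sum>k\<in>E. ricci_tensor br g (A (A' k) - A' (A k)) k) =
      c * (tr (\<lambda>Y. A (A' Y)) - tr (\<lambda>Y. A' (A Y)))
      + (tr (\<lambda>Y. D (A (A' Y))) - tr (\<lambda>Y. D (A' (A Y))))"
    by (simp add: ricci_tensor_soliton tr_def g_simps D.diff sum_distrib_left sum_subtractf
        sum.distrib right_diff_distrib)
  also have "tr (\<lambda>Y. D (A (A' Y))) = d * tr (\<lambda>Y. A (A' Y)) + tr (\<lambda>Y. A (D (A' Y)))"
    by (simp add: tr_def der g_simps sum.distrib sum_distrib_left)
  finally have "(\<Sum>k\<in>E. ricci_tensor br g (A (A' k) - A' (A k)) k) = d * tr (\<lambda>Y. A' (A Y))"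
    by (simp add: swap swap')
  also have "tr (\<lambda>Y. A' (A Y)) = (\<Sum>e\<in>E. g (A e) (A e))"
    by (simp add: tr_def A'_def g_adj[OF A])
  finally have eq: "d * (\<Sum>e\<in>E. g (A e) (A e)) =
      (\<Sum>e\<in>E. \<Sum>f\<in>E. g (defect A' e f) (defect A' e f)) / 4"
    using sum_ricci_tensor_commutator[of A] derivation_ad by (simp add: A_def A'_def)
  have "(\<Sum>e\<in>E. \<Sum>f\<in>E. g (defect A' e f) (defect A' e f)) \<noteq> 0"
  proof
    assume "(\<Sum>e\<in>E. \<Sum>f\<in>E. g (defect A' e f) (defect A' e f)) = 0"
    then have "defect A' e f = 0" if "e \<in> E" "f \<in> E" for e f
      using that finE g_nonneg by (simp add: sum_nonneg_eq_0_iff sum_nonneg g_eq_0_iff)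
    then have "lie_derivation br A'" by (rule derivation_if_defect[OF A'])
    then show False using adj_ad_not_derivation(2)[OF False] by (simp add: A_def A'_def)
  qed
  moreover have "(\<Sum>e\<in>E. \<Sum>f\<in>E. g (defect A' e f) (defect A' e f)) \<ge> 0"
    by (intro sum_nonneg g_nonneg)
  ultimately have "d * (\<Sum>e\<in>E. g (A e) (A e)) > 0" by (simp add: eq)
  then show ?thesis
    using adj_ad_not_derivation(1)[OF False] by (simp add: A_def zero_less_mult_iff)
qed

lemma T_star_solitary: "T_star_solitary br"
  unfolding T_star_solitary_def
proof (intro allI impI, elim conjE)
  fix \<phi> :: "'a \<Rightarrow> 'a \<Rightarrow> real"
  assume bil: "bilinear \<phi>" and ad: "ad_invariant br \<phi>" and "\<phi> = dual_transpose \<phi>"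
  then have sym: "\<phi> X Y = \<phi> Y X" for X Y by (metis dual_transpose_def)
  obtain B d where frame: "orthonormal_frame g B" and eigen: "\<And>b. b \<in> B \<Longrightarrow> D b = d b *\<^sub>R b"
    using spectral_theorem[OF D.linear_axioms D_sym] by metis
  interpret B: orthonormal_frame g B by (fact frame)
  interpret \<phi>l: linear "\<lambda>V. \<phi> V W" for W using bil by (simp add: bilinear_def)
  interpret \<phi>r: linear "\<phi> W" for W using bil by (simp add: bilinear_def)
  have d: "d b > 0" if "b \<in> B" for b
  proof (rule eigenvalue_pos[OF _ eigen[OF that]])
    show "b \<noteq> 0" using B.orthonormal[OF that that] by (auto simp: g_simps)
  qed
  \<comment> \<open>The form \<open>\<phi> (D e) f\<close> divided by the sum of the two
    eigenvalues.\<close>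
  define m where "m e f = d e / (d e + d f) * \<phi> e f" for e f
  define \<psi> where "\<psi> X Y = (\<Sum>e\<in>B. \<Sum>f\<in>B. g X e * g Y f * m e f)" for X Y
  have \<psi>: "bilinear \<psi>"
    unfolding bilinear_def
    by (intro conjI allI linearI)
      (simp_all add: \<psi>_def g_simps sum.distrib sum_distrib_left distrib_left distrib_right
        mult.assoc mult.left_commute)
  interpret \<psi>l: linear "\<lambda>V. \<psi> V W" for W using \<psi> by (simp add: bilinear_def)
  interpret \<psi>r: linear "\<psi> W" for W using \<psi> by (simp add: bilinear_def)
  \<comment> \<open>Eigenvectors of a symmetric map for distinct eigenvalues are orthogonal.\<close>
  have weight: "g X b = 0 \<or> d b = r" if "b \<in> B" "D X = r *\<^sub>R X" for X r b
    using D_sym[of X b] that eigen by (auto simp: g_simps)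
  \<comment> \<open>The formula for \<open>m\<close> is needed for arbitrary eigenvectors, since a
    bracket of basis elements is an eigenvector but need not be a multiple of one.\<close>
  have \<psi>_weight: "\<psi> X Y = r / (r + s) * \<phi> X Y" if XY: "D X = r *\<^sub>R X" "D Y = s *\<^sub>R Y" for X Y r s
  proof -
    have "\<psi> X Y = (\<Sum>e\<in>B. \<Sum>f\<in>B. g X e * g Y f * (r / (r + s) * \<phi> e f))"
      unfolding \<psi>_def m_def using weight[OF _ XY(1)] weight[OF _ XY(2)]
      by (intro sum.cong refl) (metis mult_zero_left mult_zero_right)
    also have "\<dots> = r / (r + s) * (\<Sum>e\<in>B. g X e * (\<Sum>f\<in>B. g Y f * \<phi> e f))"
      by (simp add: sum_distrib_left mult_ac)
    also have "(\<Sum>e\<in>B. g X e * (\<Sum>f\<in>B. g Y f * \<phi> e f)) = (\<Sum>e\<in>B. g X e * \<phi> e Y)"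
      using B.linear_expansion[OF \<phi>r.linear_axioms, of _ Y] by simp
    also have "\<dots> = \<phi> X Y"
      using B.linear_expansion[OF \<phi>l.linear_axioms, of X Y] by simp
    finally show ?thesis .
  qed
  \<comment> \<open>The failure of \<open>\<psi>\<close> to be a derivation, trilinear and hence
    determined on the eigenbasis.\<close>
  define T where "T X Y Z = \<psi> (br X Y) Z - \<psi> X (br Y Z) + \<psi> Y (br X Z)" for X Y Z
  have "T X Y Z = 0" for X Y Z
  proof (rule B.trilinear_zero)
    show "linear (\<lambda>X. T X Y Z)" for Y Z
      by (rule linearI) (simp_all add: T_def brl.add brl.scaleR \<psi>l.add \<psi>l.scaleR \<psi>r.add \<psi>r.scaleR
          algebra_simps)
    show "bilinear (T X)" for X
      unfolding bilinear_def
      by (intro conjI allI linearI) (simp_all add: T_def brl.add brl.scaleR brr.add brr.scaleR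
          \<psi>l.add \<psi>l.scaleR \<psi>r.add \<psi>r.scaleR algebra_simps)
    fix x y z assume B: "x \<in> B" "y \<in> B" "z \<in> B"
    have br: "D (br e f) = (d e + d f) *\<^sub>R br e f" if "e \<in> B" "f \<in> B" for e f
      using derivation_D eigen that
      by (simp add: lie_derivation_def brl.scaleR brr.scaleR scaleR_add_left)
    have "\<phi> (br x y) z = \<phi> x (br y z)" "\<phi> y (br x z) = - \<phi> (br x y) z"
    proof -
      have "\<phi> (br X Y) Z = - \<phi> Y (br X Z)" for X Y Z using ad by (simp add: ad_invariant_def)
      from this[of x y z] this[of y x z] \<phi>l.neg[of "br y x" z] br_anti[of x y]
      show "\<phi> (br x y) z = \<phi> x (br y z)" "\<phi> y (br x z) = - \<phi> (br x y) z" by simp_all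
    qed
    \<comment> \<open>All three terms have denominator \<open>d x + d y + d z\<close> and are
      multiples of \<open>\<phi> (br x y) z\<close>; the numerators \<open>d x + d y\<close>,
      \<open>- d x\<close> and \<open>- d y\<close> cancel.\<close>
    then show "T x y z = 0"
      using \<psi>_weight[OF br[OF B(1,2)] eigen[OF B(3)]] \<psi>_weight[OF eigen[OF B(1)] br[OF B(2,3)]]
        \<psi>_weight[OF eigen[OF B(2)] br[OF B(1,3)]]
      by (simp add: T_def add_ac add_divide_distrib distrib_right)
  qed
  then have "\<psi> (br X Y) Z = \<psi> X (br Y Z) - \<psi> Y (br X Z)" for X Y Z
    by (simp add: T_def algebra_simps)
  then have "dual_derivation br \<psi>" using \<psi> by (simp add: dual_derivation_def)
  moreover have "\<phi> X Y = \<psi> X Y + dual_transpose \<psi> X Y" for X Y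
  proof (rule B.bilinear_eqI[OF bil])
    show "bilinear (\<lambda>X Y. \<psi> X Y + dual_transpose \<psi> X Y)"
      unfolding bilinear_def dual_transpose_def
      by (intro conjI allI linearI)
        (simp_all add: \<psi>l.add \<psi>l.scaleR \<psi>r.add \<psi>r.scaleR algebra_simps)
    fix e f assume B: "e \<in> B" "f \<in> B"
    \<comment> \<open>Positivity of the eigenvalues makes the denominator nonzero.\<close>
    have "d e / (d e + d f) + d f / (d f + d e) = 1" using d[OF B(1)] d[OF B(2)]
      by (simp add: add.commute flip: add_divide_distrib)
    then have "\<phi> e f = d e / (d e + d f) * \<phi> e f + d f / (d f + d e) * \<phi> e f"
      by (simp only: mult_1_left flip: distrib_right)
    then show "\<phi> e f = \<psi> e f + dual_transpose \<psi> e f"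
      using \<psi>_weight[OF eigen[OF B(1)] eigen[OF B(2)]] \<psi>_weight[OF eigen[OF B(2)] eigen[OF B(1)]]
      by (simp add: dual_transpose_def sym[of f e])
  qed
  ultimately show "\<exists>D. dual_derivation br D \<and> (\<forall>X Y. \<phi> X Y = D X Y + dual_transpose D X Y)"
    by blast
qed

end

section \<open>Abelian case and conclusion\<close>

text \<open>For the zero bracket every bilinear form is a derivation into the dual, so half of
  \<open>\<phi>\<close> serves.\<close>

lemma T_star_solitary_abelian:
  assumes "\<And>X Y. br X Y = 0"
  shows "T_star_solitary br"
  unfolding T_star_solitary_def
proof (intro allI impI, elim conjE)
  fix \<phi> :: "'a \<Rightarrow> 'a \<Rightarrow> real"
  assume bil: "bilinear \<phi>" and "\<phi> = dual_transpose \<phi>"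
  then have "\<phi> X Y = \<phi> Y X" for X Y by (metis dual_transpose_def)
  then have "\<phi> X Y = \<phi> X Y / 2 + dual_transpose (\<lambda>X Y. \<phi> X Y / 2) X Y" for X Y
    by (simp add: dual_transpose_def)
  moreover have "dual_derivation br (\<lambda>X Y. \<phi> X Y / 2)"
    using bil by (simp add: dual_derivation_def assms bilinear_def linear_iff add_divide_distrib
        bilinear_lzero[OF bil] bilinear_rzero[OF bil])
  ultimately show "\<exists>D. dual_derivation br D \<and> (\<forall>X Y. \<phi> X Y = D X Y + dual_transpose D X Y)"
    by (intro exI[of _ "\<lambda>X Y. \<phi> X Y / 2"]) simp
qed

theorem corollary5p15:
  fixes br :: "'a::real_vector \<Rightarrow> 'a \<Rightarrow> 'a"
    and g :: "'a \<Rightarrow> 'a \<Rightarrow> real"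
    and c :: real
    and D :: "'a \<Rightarrow> 'a"
  assumes "finite_dimensional TYPE('a)"
    and "nilpotent_lie_algebra br"
    and "inner_product g"
    and "lie_derivation br D"
    and "\<And>X. ricci_operator br g X = c *\<^sub>R X + D X"
  shows "T_star_solitary br"
proof (cases "\<exists>X Y. br X Y \<noteq> 0")
  case True
  obtain E where "finite E" "independent E" "span E = UNIV"
    "\<And>c d. c \<in> E \<Longrightarrow> d \<in> E \<Longrightarrow> g c d = (if c = d then 1 else 0)"
    "\<And>X. (\<Sum>e\<in>E. g X e *\<^sub>R e) = X"
    using orthonormal_basis_exists[OF assms(3,1)] by metis
  then interpret nilsoliton g E br c D
    using assms True by unfold_locales
  show ?thesis by (rule T_star_solitary)
next
  case False
  then show ?thesis by (intro T_star_solitary_abelian) simp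
qed

end
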